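(* Let $G=(\mathcal V,\mathcal E)$ be a finite undirected graph with finite label sets $X_v$ and potentials $\theta$. Suppose that in the pruning algorithm described in the context each operation $\mu\in\operatorname{arg\,min}(\dots)$ is exchanged with setting, for all nodes $v$ and all $x_v\in X_v$, $$\mu_v(x_v):=\begin{cases}1,&c_v=x_v,\\0,&c_v\notin\{x_v,\#\},\\1/|X_v|,&c_v=\#,\end{cases}$$ where $c$ is the labeling returned by an integrally correct algorithm applied to the corresponding minimization problem. Then the output labeling $x^\ast\in X_{A^\ast}$ is persistent, i.e. coincides on $A^\ast$ with a minimizer of $E_{\mathcal V}$ over $X_{\mathcal V}$.
   Context: For $A\subset\mathcal V$, $X_A=\prod_{v\in A}X_v$; $\theta_u:X_u\to\mathbb R$ and $\theta_{uv}:X_u\times X_v\to\mathbb R$ are the unary and pairwise potentials (edges are undirected, so $\theta_{uv}(x_u,x_v)$ and $\theta_{vu}(x_v,x_u)$ denote the same number). $E_A(x)=\sum_{u\in A}\theta_u(x_u)+\sum_{uv\in\mathcal E:\,u,v\in A}\theta_{uv}(x_u,x_v)$. Boundary nodes: $\partial\mathcal V_A=\{u\in A:\exists v\in\mathcal V\setminus A,\ uv\in\mathcal E\}$; boundary edges: $\partial\mathcal E_A=\{uv\in\mathcal E:u\in A,\ v\in\mathcal V\setminus A\}$. For $uv\in\partial\mathcal E_A$ with $u\in\partial\mathcal V_A$ and a test label $y_u$: $\hat\theta_{uv,y_u}(x_u)=\max_{x_v\in X_v}\theta_{uv}(x_u,x_v)$ if $x_u=y_u$, and $\hat\theta_{uv,y_u}(x_u)=\min_{x_v\in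 X_v}\theta_{uv}(x_u,x_v)$ if $x_u\neq y_u$. $\hat E_{A,y}(x)=E_A(x)+\sum_{uv\in\partial\mathcal E_A:\,u\in\partial\mathcal V_A}\hat\theta_{uv,y_u}(x_u)$ (only the restriction of $y$ to $\partial\mathcal V_A$ matters). Integrally correct algorithm: an algorithm that takes as input an energy minimization problem (a node set $B$ with label sets $X_v$ and an energy $E$ on $X_B$ that is a sum of unary and pairwise terms) and outputs a labeling $c\in\prod_{v\in B}(X_v\cup\{\#\})$, where $\#$ is an extra symbol, such that if $c_v\in X_v$ for all $v\in B$, then $c\in\operatorname{arg\,min}_{x\in X_B}E(x)$. The local polytope $\Lambda_A$ is the set of nonnegative vectors $\mu$ with components $\mu_v(x_v)$ ($v\in A$, $x_v\in X_v$) and $\mu_{uv}(x_u,x_v)$ ($uv\in\mathcal E$, $u,v\in A$) such that $\sum_{x_v\in X_v}\mu_v(x_v)=1$, $\sum_{x_v\in X_v}\mu_{uv}(x_u,x_v)=\mu_u(x_u)$ and $\sum_{x_u\in X_u}\mu_{uv}(x_u,x_v)=\mu_v(x_v)$. Energies that are sums of unary and pairwise terms are extended linearly to $\Lambda_A$ (each $f_v$ becomes $\sum_{x_v}f_v(x_v)\mu_v(x_v)$, each $f_{uv}$ becomes $\sum_{x_u,x_v}f_{uv}(x_u,x_v)\mu_{uv}(x_u,x_v)$). Pruning algorithm (before the exchange). Initialize: choose $\mu^0\in\operatorname{arg\,min}_{\mu\in\Lambda_{\mathcal V}}E_{\mathcal V}(\mu)$, set $A^0=\{u\in\mathcal V:\mu^0_u\in\{0,1\}^{|X_u|}\}$,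 $t=0$. Repeat: (1) let $x^t\in X_{A^t}$ be given by $\mu^t_u(x^t_u)=1$, $u\in A^t$; (2) choose $\mu^{t+1}\in\operatorname{arg\,min}_{\mu\in\Lambda_{A^t}}\hat E_{A^t,x^t}(\mu)$; (3) set $t:=t+1$; (4) $W^t=\{u\in\partial\mathcal V_{A^{t-1}}:\mu^t_u(x^{t-1}_u)\neq1\}$; (5) $A^t=\{u\in A^{t-1}:\mu^t_u\in\{0,1\}^{|X_u|}\}\setminus W^t$; until $A^t=A^{t-1}$. Output $A^\ast=A^t$ and $x^\ast\in X_{A^\ast}$ with $\mu^t_u(x^\ast_u)=1$ for $u\in A^\ast$. After the exchange, the minimization problem given to the integrally correct algorithm is that of $E_{\mathcal V}$ on $X_{\mathcal V}$ (initialization) and that of $\hat E_{A^t,x^t}$ on $X_{A^t}$ (iterations); only node components of $\mu$ are used. "All nodes $v$" means all nodes of the respective minimization problem.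
   Formalization: Added: the algorithm never returns # at a node with |X_v|=1 (vacuous if all |X_v|≥2). Otherwise # there gives μ_v=1, so the node counts as integral and a non-optimal labeling can be output. Label sets are taken nonempty. *)

theory Defs
  imports Complex_Main "HOL-Library.FuncSet"
begin

text \<open>
  The edge relation is symmetric: an undirected edge between u and v is represented by both pairs
  (u, v) and (v, u), and the pairwise potential takes the same value in both directions.
\<close>

record ('v, 'l) problem =
  nodes :: "'v set"
  edges :: "('v \<times> 'v) set"
  labels :: "'v \<Rightarrow> 'l set"
  unary :: "'v \<Rightarrow> 'l \<Rightarrow> real"
  pairwise :: "'v \<Rightarrow> 'v \<Rightarrow> 'l \<Rightarrow> 'l \<Rightarrow> real"

definition energy_problem :: "('v, 'l) problem \<Rightarrow> bool" where
  "energy_problem P \<longleftrightarrow>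
     finite (nodes P) \<and>
     edges P \<subseteq> nodes P \<times> nodes P \<and> sym (edges P) \<and> irrefl (edges P) \<and>
     (\<forall>v\<in>nodes P. finite (labels P v) \<and> labels P v \<noteq> {}) \<and>
     (\<forall>(u, v)\<in>edges P. \<forall>a\<in>labels P u. \<forall>b\<in>labels P v. pairwise P u v a b = pairwise P v u b a)"

abbreviation labelings :: "('v, 'l) problem \<Rightarrow> ('v \<Rightarrow> 'l) set" where
  "labelings P \<equiv> PiE (nodes P) (labels P)"

text \<open>Every undirected edge contributes two equal summands to the sum over pairs, hence the halving.\<close>

definition energy :: "('v, 'l) problem \<Rightarrow> ('v \<Rightarrow> 'l) \<Rightarrow> real" where
  "energy P x = (\<Sum>u\<in>nodes P. unary P u (x u))
              + (\<Sum>(u, v)\<in>edges P. pairwise P u v (x u) (x v)) / 2"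

definition minimizer :: "('v, 'l) problem \<Rightarrow> ('v \<Rightarrow> 'l) \<Rightarrow> bool" where
  "minimizer P x \<longleftrightarrow> is_arg_min (energy P) (\<lambda>y. y \<in> labelings P) x"

definition persistent :: "('v, 'l) problem \<Rightarrow> 'v set \<Rightarrow> ('v \<Rightarrow> 'l) \<Rightarrow> bool" where
  "persistent P A x \<longleftrightarrow> (\<exists>y. minimizer P y \<and> (\<forall>u\<in>A. x u = y u))"

text \<open>The value None plays the role of the extra symbol #.\<close>

type_synonym ('v, 'l) algorithm = "('v, 'l) problem \<Rightarrow> 'v \<Rightarrow> 'l option"

definition integrally_correct :: "('v, 'l) algorithm \<Rightarrow> bool" where
  "integrally_correct alg \<longleftrightarrow>
     (\<forall>P. energy_problem P \<longrightarrow>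
        (\<forall>v\<in>nodes P. alg P v \<in> insert None (Some ` labels P v)) \<and>
        ((\<forall>v\<in>nodes P. alg P v \<noteq> None) \<longrightarrow>
           minimizer P (\<lambda>v\<in>nodes P. the (alg P v))))"

text \<open>
  At a node with a single label, the marginal 1 / card assigned to # is 1 and hence
  indistinguishable from a genuine label, so an algorithm could claim integrality there without
  any optimality guarantee. The following condition excludes this; it is vacuous if every node
  of P has at least two labels.
\<close>

definition labels_singletons :: "('v, 'l) algorithm \<Rightarrow> ('v, 'l) problem \<Rightarrow> bool" where
  "labels_singletons alg P \<longleftrightarrow>
     (\<forall>Q. energy_problem Q \<and> nodes Q \<subseteq> nodes P \<and> labels Q = labels P \<longrightarrow>
        (\<forall>v\<in>nodes Q. card (labels P v) = 1 \<longrightarrow> alg Q v \<noteq> None))"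

definition boundary_nodes :: "('v, 'l) problem \<Rightarrow> 'v set \<Rightarrow> 'v set" where
  "boundary_nodes P A = {u \<in> A. \<exists>v\<in>nodes P - A. (u, v) \<in> edges P}"

text \<open>Boundary edges are oriented from the inside to the outside, so each one occurs once.\<close>

definition boundary_edges :: "('v, 'l) problem \<Rightarrow> 'v set \<Rightarrow> ('v \<times> 'v) set" where
  "boundary_edges P A = {(u, v) \<in> edges P. u \<in> A \<and> v \<in> nodes P - A}"

definition boundary_potential :: "('v, 'l) problem \<Rightarrow> 'v \<Rightarrow> 'v \<Rightarrow> 'l \<Rightarrow> 'l \<Rightarrow> real" where
  "boundary_potential P u v y_u a =
     (if a = y_u then Max (pairwise P u v a ` labels P v) else Min (pairwise P u v a ` labels P v))"

definition subproblem :: "('v, 'l) problem \<Rightarrow> 'v set \<Rightarrow> ('v, 'l) problem" where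
  "subproblem P A = P\<lparr>nodes := A, edges := edges P \<inter> A \<times> A\<rparr>"

definition boundary_problem ::
    "('v, 'l) problem \<Rightarrow> 'v set \<Rightarrow> ('v \<Rightarrow> 'l) \<Rightarrow> ('v, 'l) problem" where
  "boundary_problem P A y = (subproblem P A)
     \<lparr>unary := \<lambda>u a. unary P u a
        + (\<Sum>v | (u, v) \<in> boundary_edges P A. boundary_potential P u v (y u) a)\<rparr>"

lemma energy_boundary_problem:
  assumes "energy_problem P" and "A \<subseteq> nodes P"
  shows "energy (boundary_problem P A y) x = energy (subproblem P A) x
           + (\<Sum>(u, v)\<in>boundary_edges P A. boundary_potential P u v (y u) (x u))"
proof -
  have fin: "finite (nodes P)" "finite A"
    using assms finite_subset by (auto simp: energy_problem_def)
  have fin_nb: "finite {v. (u, v) \<in> boundary_edges P A}" for u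
    by (rule finite_subset[OF _ fin(1)]) (auto simp: boundary_edges_def)
  have "boundary_edges P A = Sigma A (\<lambda>u. {v. (u, v) \<in> boundary_edges P A})"
    by (auto simp: boundary_edges_def)
  then have "(\<Sum>(u, v)\<in>boundary_edges P A. boundary_potential P u v (y u) (x u))
      = (\<Sum>u\<in>A. \<Sum>v | (u, v) \<in> boundary_edges P A. boundary_potential P u v (y u) (x u))"
    using sum.Sigma[of A "\<lambda>u. {v. (u, v) \<in> boundary_edges P A}"
        "\<lambda>u v. boundary_potential P u v (y u) (x u)"] fin fin_nb by simp
  then show ?thesis
    by (simp add: energy_def boundary_problem_def subproblem_def sum.distrib)
qed

definition node_marginals ::
    "('v, 'l) problem \<Rightarrow> ('v \<Rightarrow> 'l option) \<Rightarrow> 'v \<Rightarrow> 'l \<Rightarrow> real" where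
  "node_marginals P c v a =
     (case c v of None \<Rightarrow> 1 / real (card (labels P v)) | Some b \<Rightarrow> if b = a then 1 else 0)"

definition integral_nodes :: "('v, 'l) problem \<Rightarrow> 'v set \<Rightarrow> ('v \<Rightarrow> 'l \<Rightarrow> real) \<Rightarrow> 'v set" where
  "integral_nodes P A \<mu> = {u \<in> A. \<forall>a\<in>labels P u. \<mu> u a \<in> {0, 1}}"

definition integral_labeling ::
    "('v, 'l) problem \<Rightarrow> 'v set \<Rightarrow> ('v \<Rightarrow> 'l \<Rightarrow> real) \<Rightarrow> 'v \<Rightarrow> 'l" where
  "integral_labeling P A \<mu> = (\<lambda>u\<in>A. THE a. a \<in> labels P u \<and> \<mu> u a = 1)"

definition pruning_init ::
    "('v, 'l) algorithm \<Rightarrow> ('v, 'l) problem \<Rightarrow> 'v set \<times> ('v \<Rightarrow> 'l \<Rightarrow> real)" where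
  "pruning_init alg P =
     (let \<mu> = node_marginals P (alg P) in (integral_nodes P (nodes P) \<mu>, \<mu>))"

definition pruning_step ::
    "('v, 'l) algorithm \<Rightarrow> ('v, 'l) problem \<Rightarrow>
     'v set \<times> ('v \<Rightarrow> 'l \<Rightarrow> real) \<Rightarrow> 'v set \<times> ('v \<Rightarrow> 'l \<Rightarrow> real)" where
  "pruning_step alg P = (\<lambda>(A, \<mu>).
     let x = integral_labeling P A \<mu>;
         Q = boundary_problem P A x;
         \<mu>' = node_marginals Q (alg Q);
         W = {u \<in> boundary_nodes P A. \<mu>' u (x u) \<noteq> 1}
     in (integral_nodes P A \<mu>' - W, \<mu>'))"

primrec pruning_state ::
    "('v, 'l) algorithm \<Rightarrow> ('v, 'l) problem \<Rightarrow> nat \<Rightarrow> 'v set \<times> ('v \<Rightarrow> 'l \<Rightarrow> real)" where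
  "pruning_state alg P 0 = pruning_init alg P"
| "pruning_state alg P (Suc t) = pruning_step alg P (pruning_state alg P t)"

abbreviation pruning_set :: "('v, 'l) algorithm \<Rightarrow> ('v, 'l) problem \<Rightarrow> nat \<Rightarrow> 'v set" where
  "pruning_set alg P t \<equiv> fst (pruning_state alg P t)"

text \<open>The loop body is executed at least once; the loop is left at the first repetition.\<close>

definition pruning_output ::
    "('v, 'l) algorithm \<Rightarrow> ('v, 'l) problem \<Rightarrow> 'v set \<Rightarrow> ('v \<Rightarrow> 'l) \<Rightarrow> bool" where
  "pruning_output alg P A x \<longleftrightarrow>
     (\<exists>t\<ge>1. pruning_set alg P t = pruning_set alg P (t - 1) \<and>
        (\<forall>s\<in>{1..<t}. pruning_set alg P s \<noteq> pruning_set alg P (s - 1)) \<and>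
        A = pruning_set alg P t \<and>
        x = integral_labeling P A (snd (pruning_state alg P t)))"

end

(*
  When the loop stops, no node is discarded in the last round, so the algorithm returned an integral
  labeling x for the boundary problem whose test labeling agrees with x on the boundary. Hence x is
  optimal for that problem. Overwriting a global minimizer y by x on A does not increase the energy:
  on a boundary edge the change theta(x_u, y_v) - theta(y_u, y_v) is zero if x_u = y_u and at most
  max theta(x_u, _) - min theta(y_u, _) otherwise, i.e. at most the change of the boundary potential.
*)
theory Submission imports Defs begin

section \<open>Energies and their decomposition along a node set\<close>

lemma finite_edges:
  assumes "energy_problem P"
  shows "finite (edges P)"
  using assms unfolding energy_problem_def by (meson finite_SigmaI finite_subset)

text \<open>Elements of \<open>PiE\<close> are \<open>undefined\<close> off the node set, so a
  restricted or overwritten labeling equals the original only on the nodes. As edges stay within the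
  nodes, this already fixes the energy.\<close>

lemma energy_cong:
  assumes "edges P \<subseteq> nodes P \<times> nodes P" and "\<And>u. u \<in> nodes P \<Longrightarrow> x u = y u"
  shows "energy P x = energy P y"
proof -
  have "(\<Sum>(u, v)\<in>edges P. pairwise P u v (x u) (x v))
      = (\<Sum>(u, v)\<in>edges P. pairwise P u v (y u) (y v))"
    using assms by (intro sum.cong) auto
  then show ?thesis
    using assms(2) by (simp add: energy_def)
qed

lemma subproblem_sel [simp]:
  "nodes (subproblem P A) = A"
  "edges (subproblem P A) = edges P \<inter> A \<times> A"
  "labels (subproblem P A) = labels P"
  "unary (subproblem P A) = unary P"
  "pairwise (subproblem P A) = pairwise P"
  by (simp_all add: subproblem_def)

lemma boundary_problem_sel [simp]:
  "nodes (boundary_problem P A y) = A"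
  "edges (boundary_problem P A y) = edges P \<inter> A \<times> A"
  "labels (boundary_problem P A y) = labels P"
  "pairwise (boundary_problem P A y) = pairwise P"
  by (simp_all add: boundary_problem_def)

lemma energy_problem_boundary_problem:
  assumes "energy_problem P" and "A \<subseteq> nodes P"
  shows "energy_problem (boundary_problem P A y)"
  using assms finite_subset[of A "nodes P"]
  by (auto simp: energy_problem_def sym_def irrefl_def)

text \<open>An edge lies in A, lies in the complement, or crosses. Both orientations of a crossing
  edge belong to \<open>edges P\<close>, and the halving in \<open>energy\<close> leaves one copy,
  the one oriented outwards.\<close>

lemma energy_split:
  assumes P: "energy_problem P" and A: "A \<subseteq> nodes P" and x: "x \<in> labelings P"
  shows "energy P x = energy (subproblem P A) x + energy (subproblem P (nodes P - A)) x
           + (\<Sum>(u, v)\<in>boundary_edges P A. pairwise P u v (x u) (x v))"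
proof -
  let ?f = "\<lambda>(u, v). pairwise P u v (x u) (x v)"
  let ?B = "nodes P - A"
  let ?D = "boundary_edges P A"
  have E: "edges P \<subseteq> nodes P \<times> nodes P" and sym: "sym (edges P)"
    using P by (auto simp: energy_problem_def)
  have fin: "finite (edges P)" "finite (nodes P)"
    using P finite_edges by (auto simp: energy_problem_def)
  have D: "?D \<subseteq> edges P" "?D\<inverse> \<subseteq> edges P"
    using sym by (auto simp: boundary_edges_def sym_def)
  have finD: "finite ?D" "finite (?D\<inverse>)"
    using D fin finite_subset by blast+
  have split: "edges P = ((edges P \<inter> A \<times> A) \<union> (edges P \<inter> ?B \<times> ?B)) \<union> (?D \<union> ?D\<inverse>)"
    using E symD[OF sym] by (auto simp: boundary_edges_def)
  have "sum ?f (edges P)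
      = sum ?f ((edges P \<inter> A \<times> A) \<union> (edges P \<inter> ?B \<times> ?B)) + sum ?f (?D \<union> ?D\<inverse>)"
    by (subst split, rule sum.union_disjoint) (use fin finD in \<open>auto simp: boundary_edges_def\<close>)
  also have "sum ?f ((edges P \<inter> A \<times> A) \<union> (edges P \<inter> ?B \<times> ?B))
      = sum ?f (edges P \<inter> A \<times> A) + sum ?f (edges P \<inter> ?B \<times> ?B)"
    by (rule sum.union_disjoint) (use fin in auto)
  also have "sum ?f (?D \<union> ?D\<inverse>) = sum ?f ?D + sum ?f (?D\<inverse>)"
    by (rule sum.union_disjoint) (use finD in \<open>auto simp: boundary_edges_def\<close>)
  also have "sum ?f (?D\<inverse>) = sum ?f ?D"
  proof (rule sum.reindex_bij_witness[of _ prod.swap prod.swap])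
    fix e assume "e \<in> ?D\<inverse>"
    moreover obtain u v where "e = (u, v)"
      by fastforce
    ultimately have e: "e = (u, v)" "(u, v) \<in> edges P" "u \<in> nodes P" "v \<in> nodes P"
      using D(2) E by blast+
    \<comment> \<open>\<open>energy_problem\<close> demands symmetry of \<open>pairwise\<close> only
      for admissible labels, so x has to be a labeling here.\<close>
    then have "x u \<in> labels P u" "x v \<in> labels P v"
      using x by auto
    then show "?f (prod.swap e) = ?f e"
      using P e by (auto simp: energy_problem_def)
  qed auto
  finally have pairs: "sum ?f (edges P)
      = sum ?f (edges P \<inter> A \<times> A) + sum ?f (edges P \<inter> ?B \<times> ?B) + (sum ?f ?D + sum ?f ?D)" .
  have nodes: "(\<Sum>u\<in>nodes P. unary P u (x u)) = (\<Sum>u\<in>A. unary P u (x u)) + (\<Sum>u\<in>?B. unary P u (x u))"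
    using A fin by (simp add: sum.subset_diff)
  show ?thesis
    unfolding energy_def subproblem_sel pairs nodes by (simp add: field_simps)
qed

section \<open>Minimizers and the exchange argument\<close>

lemma ex_minimizer:
  assumes P: "energy_problem P"
  shows "\<exists>x. minimizer P x"
proof -
  have "finite (labelings P)" "labelings P \<noteq> {}"
    using P by (auto simp: energy_problem_def PiE_eq_empty_iff intro: finite_PiE)
  then show ?thesis
    using ex_is_arg_min_if_finite[of "labelings P" "energy P"] by (simp add: minimizer_def)
qed

lemma minimizer_iff:
  "minimizer P x \<longleftrightarrow> x \<in> labelings P \<and> (\<forall>y\<in>labelings P. energy P x \<le> energy P y)"
  by (auto simp: minimizer_def is_arg_min_linorder)

lemma persistent_of_boundary_minimizer:
  assumes P: "energy_problem P" and A: "A \<subseteq> nodes P"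
    and x: "minimizer (boundary_problem P A y) x"
    and xy: "\<And>u. u \<in> boundary_nodes P A \<Longrightarrow> x u = y u"
  shows "persistent P A x"
proof -
  obtain w where w: "w \<in> labelings P" "\<And>z. z \<in> labelings P \<Longrightarrow> energy P w \<le> energy P z"
    using ex_minimizer[OF P] by (auto simp: minimizer_iff)
  define z where "z = (\<lambda>u. if u \<in> A then x u else w u)"
  have xA: "x \<in> PiE A (labels P)"
    and xmin: "\<And>x'. x' \<in> PiE A (labels P) \<Longrightarrow>
      energy (boundary_problem P A y) x \<le> energy (boundary_problem P A y) x'"
    using x by (auto simp: minimizer_iff)
  have z: "z \<in> labelings P"
    using xA w(1) A by (auto simp: z_def PiE_iff extensional_def)
  let ?D = "boundary_edges P A"
  let ?B = "nodes P - A"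
  let ?bp = "\<lambda>x. \<Sum>(u, v)\<in>?D. boundary_potential P u v (y u) (x u)"
  let ?pw = "\<lambda>x. \<Sum>(u, v)\<in>?D. pairwise P u v (x u) (x v)"
  have edge: "pairwise P u v (z u) (z v) - pairwise P u v (w u) (w v)
      \<le> boundary_potential P u v (y u) (z u) - boundary_potential P u v (y u) (w u)"
    if uv: "(u, v) \<in> ?D" for u v
  proof -
    have u: "u \<in> A" "v \<in> nodes P" "v \<notin> A" and bd: "u \<in> boundary_nodes P A"
      using uv by (auto simp: boundary_edges_def boundary_nodes_def)
    \<comment> \<open>Agreement with the test labeling puts the maximum of the boundary potential at
      the new label \<open>z u\<close>; an old label \<open>w u\<close> different from it gets the
      minimum.\<close>
    have zy: "z u = y u" "z v = w v"
      using u xy[OF bd] by (auto simp: z_def)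
    have fin: "finite (labels P v)" and wv: "w v \<in> labels P v"
      using P w(1) u by (auto simp: energy_problem_def)
    show ?thesis
    proof (cases "w u = y u")
      case True
      then show ?thesis by (simp add: zy)
    next
      case False
      have "pairwise P u v (y u) (w v) \<le> Max (pairwise P u v (y u) ` labels P v)"
        "Min (pairwise P u v (w u) ` labels P v) \<le> pairwise P u v (w u) (w v)"
        using fin wv by auto
      then show ?thesis
        using False by (simp add: zy boundary_potential_def)
    qed
  qed
  have "?pw z - ?pw w \<le> ?bp z - ?bp w"
    unfolding sum_subtractf[symmetric] by (rule sum_mono) (use edge in auto)
  moreover have "energy (boundary_problem P A y) z \<le> energy (boundary_problem P A y) w"
  proof -
    \<comment> \<open>x competes only with labelings of A, so w enters through its restriction; the
      energies on A do not notice the difference.\<close>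
    have "restrict w A \<in> PiE A (labels P)"
      using w(1) A by auto
    note xmin[OF this]
    moreover have "energy (boundary_problem P A y) x = energy (boundary_problem P A y) z"
      "energy (boundary_problem P A y) (restrict w A) = energy (boundary_problem P A y) w"
      by (rule energy_cong; auto simp: z_def)+
    ultimately show ?thesis by simp
  qed
  moreover have "energy (subproblem P ?B) z = energy (subproblem P ?B) w"
    by (rule energy_cong) (auto simp: z_def)
  ultimately have "energy P z \<le> energy P w"
    using energy_split[OF P A z] energy_split[OF P A w(1)]
    by (simp add: energy_boundary_problem[OF P A])
  then have "minimizer P z"
    using z w(2) by (meson minimizer_iff order_trans)
  then show ?thesis
    unfolding persistent_def by (intro exI[of _ z]) (auto simp: z_def)
qed

section \<open>Termination of the loop\<close>

lemma integral_nodes_subset: "integral_nodes P A \<mu> \<subseteq> A"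
  by (auto simp: integral_nodes_def)

lemma pruning_set_Suc_subset: "pruning_set alg P (Suc t) \<subseteq> pruning_set alg P t"
  using integral_nodes_subset
  by (cases "pruning_state alg P t") (force simp: pruning_step_def Let_def)

lemma pruning_set_subset: "pruning_set alg P t \<subseteq> nodes P"
proof (induction t)
  case 0
  then show ?case
    by (simp add: pruning_init_def Let_def integral_nodes_subset)
next
  case (Suc t)
  with pruning_set_Suc_subset show ?case
    by (rule subset_trans)
qed

text \<open>Each strict inclusion lowers the cardinality by at least one, so at most
  \<open>card (A 0)\<close> of them can follow each other.\<close>

lemma decreasing_finite_sets_stabilize:
  fixes A :: "nat \<Rightarrow> 'a set"
  assumes "finite (A 0)" and "\<And>t. A (Suc t) \<subseteq> A t"
  shows "\<exists>t. A (Suc t) = A t"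
proof (rule ccontr)
  assume "\<nexists>t. A (Suc t) = A t"
  then have psub: "A (Suc t) \<subset> A t" for t
    using assms(2) by blast
  have fin: "finite (A t)" for t
    by (induction t) (use assms finite_subset in blast)+
  have "card (A t) + t \<le> card (A 0)" for t
  proof (induction t)
    case (Suc t)
    then show ?case
      using psubset_card_mono[OF fin psub, of t] by simp
  qed simp
  from this[of "Suc (card (A 0))"] show False by simp
qed

lemma ex_pruning_output:
  assumes P: "energy_problem P"
  shows "\<exists>A x. pruning_output alg P A x"
proof -
  let ?stop = "\<lambda>t. pruning_set alg P (Suc t) = pruning_set alg P t"
  have "finite (pruning_set alg P 0)"
    using P by (intro finite_subset[OF pruning_set_subset]) (simp add: energy_problem_def)
  then have "\<exists>t. ?stop t"
    by (rule decreasing_finite_sets_stabilize) (rule pruning_set_Suc_subset)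
  \<comment> \<open>The least index is taken because \<open>pruning_output\<close> forbids earlier
    repetitions.\<close>
  then obtain t where t: "?stop t" "\<And>s. s < t \<Longrightarrow> \<not> ?stop s"
    using exists_least_iff[of ?stop] by metis
  \<comment> \<open>\<open>?stop\<close> compares a round with its successor,
    \<open>pruning_output\<close> a round with its predecessor; hence the exit round is
    \<open>Suc t\<close>.\<close>
  have "pruning_set alg P s \<noteq> pruning_set alg P (s - 1)" if "s \<in> {1..<Suc t}" for s
    using t(2)[of "s - 1"] that by (cases s) (auto simp del: pruning_state.simps)
  with t(1) have "pruning_output alg P (pruning_set alg P (Suc t))
      (integral_labeling P (pruning_set alg P (Suc t)) (snd (pruning_state alg P (Suc t))))"
    unfolding pruning_output_def
    by (intro exI[of _ "Suc t"] conjI ballI) (simp_all del: pruning_state.simps)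
  then show ?thesis by blast
qed

section \<open>Integral marginals and the exit state\<close>

text \<open>The symbol # produces the marginal \<open>1 / card\<close>, which is integral only for a
  single label, and \<open>labels_singletons\<close> excludes # there.\<close>

lemma integral_node_imp_labeled:
  assumes Q: "energy_problem Q" "nodes Q \<subseteq> nodes P" "labels Q = labels P"
    and alg: "labels_singletons alg P"
    and v: "v \<in> integral_nodes Q (nodes Q) (node_marginals Q (alg Q))"
  shows "alg Q v \<noteq> None"
proof
  assume None: "alg Q v = None"
  have vQ: "v \<in> nodes Q"
    using v by (simp add: integral_nodes_def)
  then have fin: "finite (labels Q v)" "labels Q v \<noteq> {}"
    using Q(1) by (auto simp: energy_problem_def)
  have "1 / real (card (labels Q v)) \<in> {0, 1}"
    using v None fin(2) by (auto simp: integral_nodes_def node_marginals_def)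
  \<comment> \<open>In HOL \<open>1 / 0 = 0\<close>, so the value 0 is ruled out by the label set
    being finite and nonempty.\<close>
  then have "card (labels P v) = 1"
    using fin Q(3) by auto
  then show False
    using alg Q vQ None unfolding labels_singletons_def by blast
qed

text \<open>The marginal at a labeled node is the indicator of its label, so \<open>THE\<close>
  recovers exactly the label returned by the algorithm.\<close>

lemma integral_labeling_node_marginals:
  assumes "\<And>v. v \<in> A \<Longrightarrow> \<exists>b\<in>labels P v. c v = Some b"
  shows "integral_labeling P A (node_marginals Q c) = (\<lambda>v\<in>A. the (c v))"
proof (rule ext)
  fix v
  show "integral_labeling P A (node_marginals Q c) v = (\<lambda>v\<in>A. the (c v)) v"
  proof (cases "v \<in> A")
    case True
    then obtain b where "b \<in> labels P v" "c v = Some b"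
      using assms by blast
    with True show ?thesis
      by (auto simp: integral_labeling_def node_marginals_def intro!: the_equality split: if_splits)
  qed (simp add: integral_labeling_def)
qed

text \<open>The last round returns the set it started from, so neither the integrality test nor W
  removed a node. Here y is the test labeling from the preceding round, while x comes from the last
  one; in the interior of A they may differ.\<close>

lemma pruning_output_fixpoint:
  assumes "pruning_output alg P A x"
  obtains y \<mu> where "A \<subseteq> nodes P"
    and "\<mu> = node_marginals (boundary_problem P A y) (alg (boundary_problem P A y))"
    and "x = integral_labeling P A \<mu>"
    and "A \<subseteq> integral_nodes P A \<mu>"
    and "\<And>u. u \<in> boundary_nodes P A \<Longrightarrow> \<mu> u (y u) = 1"
proof -
  obtain t where t: "t \<ge> 1" "pruning_set alg P t = pruning_set alg P (t - 1)"
      "A = pruning_set alg P t" "x = integral_labeling P A (snd (pruning_state alg P t))"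
    using assms unfolding pruning_output_def by blast
  then obtain s where s: "t = Suc s"
    by (cases t) auto
  \<comment> \<open>By the stopping condition the preceding round already has the set A; only its
    marginals \<open>\<mu>0\<close> may differ from the final ones.\<close>
  obtain \<mu>0 where state: "pruning_state alg P s = (A, \<mu>0)"
    using t s by (cases "pruning_state alg P s") auto
  define y where "y = integral_labeling P A \<mu>0"
  define \<mu> where "\<mu> = node_marginals (boundary_problem P A y) (alg (boundary_problem P A y))"
  have step: "pruning_state alg P t
      = (integral_nodes P A \<mu> - {u \<in> boundary_nodes P A. \<mu> u (y u) \<noteq> 1}, \<mu>)"
    by (simp add: s state pruning_step_def Let_def y_def \<mu>_def)
  have A: "A = integral_nodes P A \<mu> - {u \<in> boundary_nodes P A. \<mu> u (y u) \<noteq> 1}"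
    by (rule trans[OF t(3)]) (simp add: step)
  show thesis
  proof (rule that[of \<mu> y])
    show "A \<subseteq> nodes P"
      using t(3) pruning_set_subset by metis
    show "x = integral_labeling P A \<mu>"
      using t(4) step by simp
    show "A \<subseteq> integral_nodes P A \<mu>"
      using A by blast
    show "\<mu> u (y u) = 1" if "u \<in> boundary_nodes P A" for u
    proof -
      have "u \<in> A"
        using that by (simp add: boundary_nodes_def)
      then show ?thesis
        using A that by blast
    qed
  qed (rule \<mu>_def)
qed

section \<open>Persistency of the output\<close>

theorem proposition2:
  fixes P :: "('v, 'l) problem" and alg :: "('v, 'l) algorithm"
  assumes "energy_problem P"
    and "integrally_correct alg"
    and "labels_singletons alg P"
  shows "(\<exists>A x. pruning_output alg P A x) \<and>
         (\<forall>A x. pruning_output alg P A x \<longrightarrow> x \<in> PiE A (labels P) \<and> persistent P A x)"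
proof (intro conjI allI impI)
  show "\<exists>A x. pruning_output alg P A x"
    by (rule ex_pruning_output) fact
next
  fix A x assume "pruning_output alg P A x"
  then obtain y \<mu> where A: "A \<subseteq> nodes P"
    and \<mu>: "\<mu> = node_marginals (boundary_problem P A y) (alg (boundary_problem P A y))"
    and x: "x = integral_labeling P A \<mu>"
    and int: "A \<subseteq> integral_nodes P A \<mu>"
    and bd: "\<And>u. u \<in> boundary_nodes P A \<Longrightarrow> \<mu> u (y u) = 1"
    by (rule pruning_output_fixpoint) blast
  define Q where "Q = boundary_problem P A y"
  have Q: "energy_problem Q" "nodes Q = A" "labels Q = labels P"
    using energy_problem_boundary_problem[OF assms(1) A] by (simp_all add: Q_def)
  \<comment> \<open>\<open>int\<close> tests integrality with the labels of P, the lemma with those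
    of Q; boundary terms change only unary potentials, so the tests agree.\<close>
  have some: "alg Q v \<noteq> None" if "v \<in> A" for v
    using integral_node_imp_labeled[OF Q(1) _ Q(3) assms(3), of v] A int that
    by (auto simp: Q integral_nodes_def \<mu> Q_def)
  have range: "\<exists>b\<in>labels P v. alg Q v = Some b" if "v \<in> A" for v
    using assms(2) Q some[OF that] that unfolding integrally_correct_def by fastforce
  have x_eq: "x = (\<lambda>v\<in>A. the (alg Q v))"
    unfolding x \<mu> Q_def[symmetric] by (rule integral_labeling_node_marginals) (rule range)
  have min: "minimizer Q x"
    using assms(2) Q some unfolding integrally_correct_def x_eq by metis
  then show "x \<in> PiE A (labels P)"
    by (simp add: minimizer_iff Q)
  show "persistent P A x"
  proof (rule persistent_of_boundary_minimizer[OF assms(1) A])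
    show "minimizer (boundary_problem P A y) x"
      using min by (simp add: Q_def)
    fix u assume u: "u \<in> boundary_nodes P A"
    then have "u \<in> A"
      by (simp add: boundary_nodes_def)
    moreover from this obtain b where "alg Q u = Some b"
      using some by blast
    \<comment> \<open>The marginal at u is the indicator of b, so its value 1 at \<open>y u\<close>
      forces \<open>b = y u\<close>.\<close>
    ultimately show "x u = y u"
      using bd[OF u] by (simp add: x_eq \<mu> Q_def[symmetric] node_marginals_def split: if_splits)
  qed
qed

end
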